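(* Let $n\geq 3$ be a positive integer and let $R\cong \prod_{i=1}^{n}\mathbb{F}_{i}$, where $\mathbb{F}_{i}$ is a field for every $1\leq i\leq n$. Then $sdim(In(R))=2^{n}-2n+1$.
   Context: For a commutative ring $R$ with identity, the inclusion ideal graph $In(R)$ is the simple graph whose vertices are all non-trivial ideals of $R$ (ideals different from $0$ and $R$), two distinct vertices being adjacent if and only if one of them is properly contained in the other. For a graph $G$ with distance $d$, two vertices $u,v$ are strongly resolved by a vertex $w$ if $d(w,u)=d(w,v)+d(v,u)$ or $d(w,v)=d(w,u)+d(u,v)$. A set $W\subseteq V(G)$ is a strong resolving set if every two distinct vertices of $G$ are strongly resolved by some vertex of $W$. The strong metric dimension $sdim(G)$ is the minimum cardinality of a strong resolving set. *)

theory Defs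
  imports
    "HOL-Algebra.Algebra"
    "HOL-Library.Extended_Nat"
    "Graph_Theory.Graph_Theory"
begin

text \<open>Simple graphs are symmetric loop-free digraphs without parallel arcs, as in
  \<open>Graph_Theory\<close>: an edge \<open>uv\<close> is the pair of arcs \<open>(u,v)\<close> and \<open>(v,u)\<close>.\<close>

definition inclusion_ideal_graph :: "('a, 'm) ring_scheme \<Rightarrow> 'a set pair_pre_digraph" where
  "inclusion_ideal_graph R =
     (let V = {I. ideal I R \<and> I \<noteq> {\<zero>\<^bsub>R\<^esub>} \<and> I \<noteq> carrier R}
      in \<lparr> pverts = V,
           parcs = {(I, J). I \<in> V \<and> J \<in> V \<and> (I \<subset> J \<or> J \<subset> I)} \<rparr>)"

lemma inclusion_ideal_graph_bidirected:
  "pair_bidirected_digraph (inclusion_ideal_graph R)"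
proof
  show "symmetric (with_proj (inclusion_ideal_graph R))"
    by (auto simp: symmetric_def sym_def inclusion_ideal_graph_def Let_def)
qed (auto simp: inclusion_ideal_graph_def Let_def)

text \<open>Every arc has weight 1, so this is the least number of edges of a walk from \<open>u\<close> to
  \<open>v\<close>, and \<open>\<infinity>\<close> if there is none.\<close>

definition graph_dist :: "('v, 'e) pre_digraph \<Rightarrow> 'v \<Rightarrow> 'v \<Rightarrow> ereal" where
  "graph_dist G u v = wf_digraph.\<mu> G (\<lambda>_. 1) u v"

lemma graph_dist_eq:
  assumes "wf_digraph G"
  shows "graph_dist G u v = (INF p \<in> {p. pre_digraph.awalk G u p v}. ereal (real (length p)))"
proof -
  interpret wf_digraph G by fact
  show ?thesis
    by (simp add: graph_dist_def \<mu>_def awalk_cost_def sum_list_triv)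
qed

definition strongly_resolves :: "('v, 'e) pre_digraph \<Rightarrow> 'v \<Rightarrow> 'v \<Rightarrow> 'v \<Rightarrow> bool" where
  "strongly_resolves G w u v \<longleftrightarrow>
     graph_dist G w u = graph_dist G w v + graph_dist G v u \<or>
     graph_dist G w v = graph_dist G w u + graph_dist G u v"

definition strong_resolving_set :: "('v, 'e) pre_digraph \<Rightarrow> 'v set \<Rightarrow> bool" where
  "strong_resolving_set G W \<longleftrightarrow>
     W \<subseteq> verts G \<and>
     (\<forall>u \<in> verts G. \<forall>v \<in> verts G. u \<noteq> v \<longrightarrow> (\<exists>w \<in> W. strongly_resolves G w u v))"

text \<open>The infimum is \<open>\<infinity>\<close> if no finite strong resolving set exists; otherwise it is
  attained.\<close>

definition sdim :: "('v, 'e) pre_digraph \<Rightarrow> enat" where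
  "sdim G = (INF W \<in> {W. finite W \<and> strong_resolving_set G W}. enat (card W))"

end

theory Submission
  imports Defs
begin

text \<open>The nontrivial ideals of a product of \<open>n\<close> fields form the poset of proper nonempty subsets
  of an \<open>n\<close>-element set \<open>U\<close>. In its comparability graph, complementary sets are at distance 3 and
  all other incomparable sets at distance 2. A pair is resolved by a third vertex unless it is
  complementary or crossing, meaning that its four Venn regions in \<open>U\<close> are all nonempty. So the
  complement of a strong resolving set is a family without crossing or complementary pairs;
  complementing the members that contain a base point makes it a laminar family of nonempty
  subsets of an \<open>(n - 1)\<close>-element set, hence of size at most \<open>2 (n - 1) - 1\<close>. Conversely, the
  complement of a maximal such laminar family is strongly resolving, which leaves
  \<open>(2 ^ n - 2) - (2 n - 3)\<close> vertices.\<close>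

section \<open>Laminar families\<close>

definition laminar :: "'a set set \<Rightarrow> bool" where
  "laminar F \<longleftrightarrow> (\<forall>A\<in>F. \<forall>B\<in>F. A \<inter> B = {} \<or> A \<subseteq> B \<or> B \<subseteq> A)"

lemma laminarD: "laminar F \<Longrightarrow> A \<in> F \<Longrightarrow> B \<in> F \<Longrightarrow> A \<inter> B = {} \<or> A \<subseteq> B \<or> B \<subseteq> A"
  unfolding laminar_def by blast

text \<open>Induction on the ground set. Deleting a point \<open>x\<close> from all members keeps
  the family laminar and costs at most two of them: \<open>{x}\<close>, which becomes empty, and one
  half of at most one collapsing pair \<open>A\<close>, \<open>insert x A\<close>.\<close>

lemma card_laminar_le:
  assumes "finite V" "V \<noteq> {}" "F \<subseteq> Pow V - {{}}" "laminar F"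
  shows "card F \<le> 2 * card V - 1"
  using assms
proof (induction V arbitrary: F rule: finite_ne_induct)
  case (singleton x)
  then have "F \<subseteq> {{x}}" by auto
  then have "card F \<le> card {{x}}" by (intro card_mono) auto
  then show ?case by simp
next
  case (insert x V)
  define F' where "F' = (\<lambda>A. A - {x}) ` F - {{}}"
  define E where "E = {A \<in> F. x \<notin> A \<and> insert x A \<in> F}"
  have finF: "finite F"
    using insert.prems(1) insert.hyps(1) by (meson finite_Diff finite_Pow_iff finite_insert finite_subset)
  have lam: "laminar F'"
    unfolding laminar_def
  proof (intro ballI)
    fix A' B' assume "A' \<in> F'" "B' \<in> F'"
    then obtain A B where "A \<in> F" "B \<in> F" "A' = A - {x}" "B' = B - {x}"
      unfolding F'_def by auto
    then show "A' \<inter> B' = {} \<or> A' \<subseteq> B' \<or> B' \<subseteq> A'"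
      using laminarD[OF insert.prems(2), of A B] by blast
  qed
  have "F' \<subseteq> Pow V - {{}}"
    unfolding F'_def using insert.prems(1) by auto
  from insert.IH[OF this lam] have IH: "card F' \<le> 2 * card V - 1" .
  \<comment> \<open>\<open>insert x A\<close> and \<open>insert x B\<close> share \<open>x\<close>,
    so they are nested, say \<open>A\<close> inside \<open>B\<close>. Then \<open>insert x A\<close>
    meets \<open>B\<close> but cannot lie in it, so \<open>B\<close> lies inside
    \<open>A\<close>.\<close>
  have "A = B" if "A \<in> E" "B \<in> E" for A B
  proof -
    have *: "A \<in> F" "insert x A \<in> F" "x \<notin> A" "A \<noteq> {}" "B \<in> F" "insert x B \<in> F" "x \<notin> B" "B \<noteq> {}"
      using that insert.prems(1) unfolding E_def by auto
    then show ?thesis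
      using laminarD[OF insert.prems(2), of "insert x A" "insert x B"]
        laminarD[OF insert.prems(2), of "insert x A" B]
        laminarD[OF insert.prems(2), of A "insert x B"] by blast
  qed
  then have cardE: "card E \<le> 1"
    using finF by (auto simp: card_le_Suc0_iff_eq E_def)
  have "inj_on (\<lambda>A. A - {x}) (F - insert {x} E)"
  proof (rule inj_onI)
    fix A B assume A: "A \<in> F - insert {x} E" and B: "B \<in> F - insert {x} E" and eq: "A - {x} = B - {x}"
    have "A = B \<or> (x \<notin> A \<and> B = insert x A) \<or> (x \<notin> B \<and> A = insert x B)" using eq by blast
    then show "A = B" using A B unfolding E_def by auto
  qed
  moreover have "(\<lambda>A. A - {x}) ` (F - insert {x} E) \<subseteq> F'"
    unfolding F'_def using insert.prems(1) by auto
  ultimately have "card (F - insert {x} E) \<le> card F'"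
    using finF by (intro card_inj_on_le) (auto simp: F'_def)
  moreover have "card F \<le> card (F - insert {x} E) + card (insert {x} E)"
  proof -
    have "card F \<le> card ((F - insert {x} E) \<union> insert {x} E)"
      using finF by (intro card_mono) (auto simp: E_def)
    then show ?thesis using card_Un_le le_trans by blast
  qed
  moreover have "card (insert {x} E) \<le> 2"
    using cardE card_insert_le_m1[of 2 E "{x}"] by simp
  moreover have "card V \<ge> 1" using insert.hyps by (simp add: Suc_leI card_gt_0_iff)
  ultimately show ?case using IH insert.hyps by simp
qed

text \<open>A new point \<open>x\<close> pays for two further members: \<open>{x}\<close>, disjoint
  from all old members, and the enlarged ground set, which contains them.\<close>

lemma ex_laminar_card:
  assumes "finite V" "V \<noteq> {}"
  shows "\<exists>F \<subseteq> Pow V - {{}}. laminar F \<and> card F = 2 * card V - 1"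
  using assms
proof (induction V rule: finite_ne_induct)
  case (singleton x)
  show ?case by (intro exI[of _ "{{x}}"]) (auto simp: laminar_def)
next
  case (insert x V)
  then obtain F where F: "F \<subseteq> Pow V - {{}}" "laminar F" "card F = 2 * card V - 1" by blast
  have "finite F" using F(1) insert.hyps(1) by (meson finite_Diff finite_Pow_iff finite_subset)
  moreover have "{x} \<noteq> insert x V" "{x} \<notin> F" "insert x V \<notin> F"
    using F(1) insert.hyps by auto
  moreover have "card V \<ge> 1" using insert.hyps by (simp add: Suc_leI card_gt_0_iff)
  ultimately have "card (insert {x} (insert (insert x V) F)) = 2 * card (insert x V) - 1"
    using F(3) insert.hyps by simp
  moreover have "laminar (insert {x} (insert (insert x V) F))"
    unfolding laminar_def
  proof (intro ballI)
    fix A B assume "A \<in> insert {x} (insert (insert x V) F)" "B \<in> insert {x} (insert (insert x V) F)"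
    moreover have "C \<subseteq> V" if "C \<in> F" for C using that F(1) by blast
    ultimately show "A \<inter> B = {} \<or> A \<subseteq> B \<or> B \<subseteq> A"
      using laminarD[OF F(2), of A B] by blast
  qed
  moreover have "insert {x} (insert (insert x V) F) \<subseteq> Pow (insert x V) - {{}}"
    using F(1) by auto
  ultimately show ?case by blast
qed

section \<open>The comparability graph of the proper nonempty subsets\<close>

definition proper_subsets :: "'a set \<Rightarrow> 'a set set" where
  "proper_subsets U = Pow U - {{}, U}"

lemma proper_subsets_iff: "A \<in> proper_subsets U \<longleftrightarrow> A \<subseteq> U \<and> A \<noteq> {} \<and> A \<noteq> U"
  by (auto simp: proper_subsets_def)

lemma card_proper_subsets:
  assumes "finite U" "U \<noteq> {}"
  shows "card (proper_subsets U) = 2 ^ card U - 2"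
  using assms by (simp add: proper_subsets_def card_Diff_subset card_Pow)

text \<open>For finite \<open>U\<close> with at least three elements this closed form is the
  distance in the comparability graph; \<open>graph_dist_Z\<close> justifies it.\<close>

definition subset_dist :: "'a set \<Rightarrow> 'a set \<Rightarrow> 'a set \<Rightarrow> nat" where
  "subset_dist U A B =
     (if A = B then 0 else if A \<subset> B \<or> B \<subset> A then 1 else if B = U - A then 3 else 2)"

definition subset_resolves :: "'a set \<Rightarrow> 'a set \<Rightarrow> 'a set \<Rightarrow> 'a set \<Rightarrow> bool" where
  "subset_resolves U C A B \<longleftrightarrow>
     subset_dist U C A = subset_dist U C B + subset_dist U B A \<or>
     subset_dist U C B = subset_dist U C A + subset_dist U A B"

lemma subset_resolves_commute: "subset_resolves U C A B \<longleftrightarrow> subset_resolves U C B A"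
  by (auto simp: subset_resolves_def)

text \<open>Diameter 3 makes complementary pairs resolvable only by their own members; for a crossing
  pair a resolving third vertex would be the complement of one member, adjacent to the other.\<close>

lemma unresolved_pair:
  assumes "A \<in> proper_subsets U" "B \<in> proper_subsets U" "C \<in> proper_subsets U"
    and "A = U - B \<or> (A \<inter> B \<noteq> {} \<and> A \<union> B \<noteq> U \<and> \<not> A \<subseteq> B \<and> \<not> B \<subseteq> A)"
    and "subset_resolves U C A B"
  shows "C = A \<or> C = B"
proof (rule ccontr)
  assume C: "\<not> (C = A \<or> C = B)"
  have pos: "subset_dist U C A \<ge> 1" "subset_dist U C B \<ge> 1"
    using C by (auto simp: subset_dist_def)
  have le3: "subset_dist U C A \<le> 3" "subset_dist U C B \<le> 3"
    by (auto simp: subset_dist_def)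
  have sub: "A \<subseteq> U" "B \<subseteq> U" "C \<subseteq> U" "A \<noteq> {}" "B \<noteq> {}"
    using assms(1-3) by (auto simp: proper_subsets_iff)
  show False
  proof (cases "A = U - B")
    case True
    then have "subset_dist U A B = 3" "subset_dist U B A = 3"
      using sub by (auto simp: subset_dist_def)
    then show False using assms(5) pos le3 unfolding subset_resolves_def by auto
  next
    case False
    then have cross: "A \<inter> B \<noteq> {}" "A \<union> B \<noteq> U" "\<not> A \<subseteq> B" "\<not> B \<subseteq> A"
      using assms(4) by auto
    then have AB: "subset_dist U A B = 2" "subset_dist U B A = 2"
      using sub by (auto simp: subset_dist_def)
    \<comment> \<open>All distances from \<open>C\<close> lie between 1 and 3 and the pair is at
      distance 2, so 3 = 1 + 2 is the only possibility.\<close>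
    from assms(5) have "subset_dist U C A = 3 \<and> subset_dist U C B = 1
        \<or> subset_dist U C B = 3 \<and> subset_dist U C A = 1"
      using AB pos le3 unfolding subset_resolves_def by linarith
    then have "A = U - C \<and> (C \<subset> B \<or> B \<subset> C) \<or> B = U - C \<and> (C \<subset> A \<or> A \<subset> C)"
      by (auto simp: subset_dist_def split: if_splits)
    \<comment> \<open>If \<open>C\<close> is the complement of \<open>A\<close>, then
      \<open>C\<close> inside \<open>B\<close> makes \<open>A\<close> and \<open>B\<close> cover
      \<open>U\<close>, while \<open>B\<close> inside \<open>C\<close> makes them disjoint.\<close>
    then show False using cross sub by blast
  qed
qed

text \<open>Replacing each set containing a base point by its complement turns an unresolved family
  into a laminar one, without identifying any two members.\<close>

lemma card_unresolved_le:
  assumes "finite U" "card U \<ge> 3" "W \<subseteq> proper_subsets U"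
    and res: "\<And>A B. A \<in> proper_subsets U \<Longrightarrow> B \<in> proper_subsets U \<Longrightarrow> A \<noteq> B \<Longrightarrow>
               \<exists>C\<in>W. subset_resolves U C A B"
  shows "card (proper_subsets U - W) \<le> 2 * card U - 3"
proof -
  obtain r where r: "r \<in> U" using assms(2) by fastforce
  define Q where "Q = proper_subsets U - W"
  define c where "c = (\<lambda>A. if r \<in> A then U - A else A)"
  have QU: "A \<subseteq> U \<and> A \<noteq> {} \<and> A \<noteq> U" if "A \<in> Q" for A
    using that by (auto simp: Q_def proper_subsets_iff)
  have Q: "A \<noteq> U - B \<and> (A \<inter> B = {} \<or> A \<union> B = U \<or> A \<subseteq> B \<or> B \<subseteq> A)"
    if "A \<in> Q" "B \<in> Q" "A \<noteq> B" for A B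
  proof -
    have "A \<in> proper_subsets U" "B \<in> proper_subsets U" "A \<notin> W" "B \<notin> W"
      using that by (auto simp: Q_def)
    moreover from this obtain C where "C \<in> W" "subset_resolves U C A B"
      using res \<open>A \<noteq> B\<close> by blast
    ultimately show ?thesis
      using unresolved_pair[of A U B C] assms(3) by blast
  qed
  \<comment> \<open>\<open>c A = c B\<close> leaves only equal or complementary sets, and no two
    members of \<open>Q\<close> are complementary.\<close>
  have "inj_on c Q"
  proof (rule inj_onI)
    fix A B assume "A \<in> Q" "B \<in> Q" "c A = c B"
    then show "A = B" using Q[of A B] QU[of A] QU[of B] unfolding c_def
      by (auto split: if_splits)
  qed
  then have "card (c ` Q) = card Q" by (rule card_image)
  moreover have "card (c ` Q) \<le> 2 * card (U - {r}) - 1"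
  proof (rule card_laminar_le)
    have "card (U - {r}) > 0" using r assms(1,2) by simp
    then show "U - {r} \<noteq> {}" by (metis card.empty less_irrefl)
    show "c ` Q \<subseteq> Pow (U - {r}) - {{}}"
      using QU r by (auto simp: c_def)
    show "laminar (c ` Q)"
      unfolding laminar_def
    proof (intro ballI)
      fix A' B' assume "A' \<in> c ` Q" "B' \<in> c ` Q"
      then obtain A B where AB: "A \<in> Q" "B \<in> Q" "A' = c A" "B' = c B" by auto
      have "A = B \<or> A \<inter> B = {} \<or> A \<union> B = U \<or> A \<subseteq> B \<or> B \<subseteq> A"
        using Q[OF AB(1,2)] by blast
      \<comment> \<open>Complementing sets permutes the four Venn regions, so one region stays
        empty. It is not the outer one, which contains \<open>r\<close>; hence \<open>A'\<close> and
        \<open>B'\<close> are disjoint or nested.\<close>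
      then show "A' \<inter> B' = {} \<or> A' \<subseteq> B' \<or> B' \<subseteq> A'"
        unfolding AB c_def using QU[OF AB(1)] QU[OF AB(2)] r by (cases "r \<in> A"; cases "r \<in> B") auto
    qed
  qed (use assms in auto)
  ultimately show ?thesis
    using r assms(1,2) unfolding Q_def by simp
qed

text \<open>Two members \<open>A\<close>, \<open>B\<close> of the family are resolved by the complement of one of them, which
  contains the base point \<open>r\<close> and so lies outside the family.\<close>

lemma laminar_complement_resolving:
  assumes "r \<in> U" "F \<subseteq> Pow (U - {r}) - {{}}" "laminar F"
    and "A \<in> proper_subsets U" "B \<in> proper_subsets U" "A \<noteq> B"
  shows "\<exists>C \<in> proper_subsets U - F. subset_resolves U C A B"
proof -
  \<comment> \<open>\<open>U - B\<close> is at distance 3 from \<open>B\<close>; it is disjoint from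
    \<open>A\<close> without being its complement, hence at distance 2 from \<open>A\<close>. The
    resolving equation is 3 = 2 + 1.\<close>
  have nested: "subset_resolves U (U - B) A B \<and> U - B \<in> proper_subsets U - F"
    if "A \<in> F" "B \<in> F" "A \<subset> B" for A B
  proof -
    have *: "A \<subseteq> U - {r}" "B \<subseteq> U - {r}" "A \<noteq> {}" using that assms(2) by auto
    have "subset_dist U (U - B) B = 3"
      using * assms(1) that(3) by (auto simp: subset_dist_def)
    moreover have "subset_dist U (U - B) A = 2"
      using * assms(1) that(3) by (auto simp: subset_dist_def)
    moreover have "subset_dist U A B = 1" using that(3) by (auto simp: subset_dist_def)
    moreover have "U - B \<in> proper_subsets U - F"
      using * assms(1,2) that(3) by (auto simp: proper_subsets_iff)
    ultimately show ?thesis by (simp add: subset_resolves_def)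
  qed
  show ?thesis
  proof (cases "A \<in> F \<and> B \<in> F")
    case False
    have "subset_resolves U A A B" "subset_resolves U B A B"
      by (auto simp: subset_resolves_def subset_dist_def)
    then show ?thesis using False assms(4,5) by blast
  next
    case True
    then consider "A \<subset> B" | "B \<subset> A" | "A \<inter> B = {}"
      using laminarD[OF assms(3), of A B] assms(6) by blast
    then show ?thesis
    proof cases
      case 1
      then show ?thesis using nested[of A B] True by blast
    next
      case 2
      then show ?thesis using nested[of B A] True subset_resolves_commute by blast
    next
      case 3
      have *: "A \<subseteq> U - {r}" "B \<subseteq> U - {r}" "A \<noteq> {}" "B \<noteq> {}" using True assms(2) by auto
      \<comment> \<open>Neither set contains \<open>r\<close>, so \<open>B\<close> is a proper
        subset of \<open>U - A\<close> and the two are not complementary. The resolving equation is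
        3 = 1 + 2.\<close>
      have "subset_dist U (U - A) A = 3"
        using * assms(1) by (auto simp: subset_dist_def)
      moreover have "subset_dist U (U - A) B = 1"
        using * assms(1) 3 by (auto simp: subset_dist_def)
      moreover have "subset_dist U B A = 2"
        using * assms(1) 3 by (auto simp: subset_dist_def)
      moreover have "U - A \<in> proper_subsets U - F"
        using * assms(1,2) by (auto simp: proper_subsets_iff)
      ultimately show ?thesis
        by (intro bexI[of _ "U - A"]) (simp_all add: subset_resolves_def)
    qed
  qed
qed

section \<open>Graph distances and the strong metric dimension of the comparability graph\<close>

lemma (in wf_digraph) graph_dist_eqI:
  assumes "awalk u p v" "\<And>q. awalk u q v \<Longrightarrow> length p \<le> length q"
  shows "graph_dist G u v = ereal (real (length p))"
  unfolding graph_dist_eq[OF wf_digraph_axioms]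
  using assms by (intro INF_eqI) auto

text \<open>Labelling the vertices by sets separates the counting from ring theory. Three points are
  needed for connectedness: over two points the graph consists of two isolated vertices.\<close>

locale subset_comparability_graph =
  fixes G :: "'v pair_pre_digraph" and U :: "'b set" and Z :: "'b set \<Rightarrow> 'v"
  assumes finite_U: "finite U"
    and card_U: "card U \<ge> 3"
    and inj_Z: "inj_on Z (proper_subsets U)"
    and pverts_eq: "pverts G = Z ` proper_subsets U"
    and parcs_eq: "parcs G = {(Z A, Z B) | A B.
      A \<in> proper_subsets U \<and> B \<in> proper_subsets U \<and> (A \<subset> B \<or> B \<subset> A)}"
begin

sublocale pair_wf_digraph G
  by unfold_locales (auto simp: parcs_eq pverts_eq)

lemma arc_iff:
  "A \<in> proper_subsets U \<Longrightarrow> B \<in> proper_subsets U \<Longrightarrow> (Z A, Z B) \<in> parcs G \<longleftrightarrow> A \<subset> B \<or> B \<subset> A"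
  unfolding parcs_eq using inj_onD[OF inj_Z] by blast

lemma vert: "A \<in> proper_subsets U \<Longrightarrow> Z A \<in> pverts G"
  by (simp add: pverts_eq)

text \<open>Serves the lower bound 3 for complementary sets: a shorter walk between distinct
  non-adjacent vertices yields a common neighbour.\<close>

lemma short_awalk:
  assumes "awalk u q v" "length q \<le> 2"
  shows "u = v \<or> (u, v) \<in> parcs G \<or> (\<exists>w\<in>pverts G. (u, w) \<in> parcs G \<and> (w, v) \<in> parcs G)"
proof -
  consider "q = []" | a b where "q = [(a, b)]" | a b c d where "q = [(a, b), (c, d)]"
    using assms(2) by (cases q; cases "tl q"; cases "tl (tl q)") auto
  then show ?thesis
    using assms(1) by cases (force simp: awalk_simps dest: in_arcsD1)+
qed

lemma length_le_1_awalk: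
  assumes "awalk u q v" "length q \<le> 1"
  shows "u = v \<or> (u, v) \<in> parcs G"
proof -
  consider "q = []" | a b where "q = [(a, b)]"
    using assms(2) by (cases q; cases "tl q") auto
  then show ?thesis
    using assms(1) by cases (auto simp: awalk_simps)
qed

text \<open>Each case exhibits a walk and excludes shorter ones. Incomparable sets have a common
  neighbour exactly when they are not complementary.\<close>

lemma graph_dist_Z:
  assumes A: "A \<in> proper_subsets U" and B: "B \<in> proper_subsets U"
  shows "graph_dist G (Z A) (Z B) = ereal (real (subset_dist U A B))"
proof -
  have sub: "A \<subseteq> U" "B \<subseteq> U" "A \<noteq> {}" "B \<noteq> {}" "A \<noteq> U" "B \<noteq> U"
    using A B by (auto simp: proper_subsets_iff)
  have eq: "Z A = Z B \<longleftrightarrow> A = B" using inj_onD[OF inj_Z] A B by blast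
  have "\<exists>p. awalk (Z A) p (Z B) \<and> length p = subset_dist U A B \<and>
     (\<forall>q. awalk (Z A) q (Z B) \<longrightarrow> length p \<le> length q)"
  proof -
    consider "A = B" | "A \<subset> B \<or> B \<subset> A"
      | "A \<noteq> B" "\<not> (A \<subset> B \<or> B \<subset> A)" "B \<noteq> U - A"
      | "A \<noteq> B" "\<not> (A \<subset> B \<or> B \<subset> A)" "B = U - A" by blast
    then show ?thesis
    proof cases
      case 1
      then show ?thesis using vert[OF A]
        by (intro exI[of _ "[]"]) (auto simp: awalk_simps subset_dist_def)
    next
      case 2
      then have "(Z A, Z B) \<in> parcs G" "A \<noteq> B" using arc_iff A B by auto
      then have "awalk (Z A) [(Z A, Z B)] (Z B)"
        using vert[OF B] by (auto simp: awalk_simps)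
      moreover have "length q \<ge> 1" if "awalk (Z A) q (Z B)" for q
        using that eq \<open>A \<noteq> B\<close> by (cases q) (auto simp: awalk_simps)
      ultimately show ?thesis using 2 \<open>A \<noteq> B\<close>
        by (intro exI[of _ "[(Z A, Z B)]"]) (auto simp: subset_dist_def)
    next
      case 3
      \<comment> \<open>The union of disjoint sets is proper because they are not complementary; if
        the sets meet, their intersection serves.\<close>
      obtain C where C: "C \<in> proper_subsets U" "C \<subset> A \<and> C \<subset> B \<or> A \<subset> C \<and> B \<subset> C"
      proof (cases "A \<inter> B = {}")
        case True
        then have "A \<union> B \<in> proper_subsets U" using 3 sub by (auto simp: proper_subsets_iff)
        moreover have "A \<subset> A \<union> B \<and> B \<subset> A \<union> B" using 3 by auto
        ultimately show ?thesis using that by blast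
      next
        case False
        then have "A \<inter> B \<in> proper_subsets U" using 3 sub by (auto simp: proper_subsets_iff)
        moreover have "A \<inter> B \<subset> A \<and> A \<inter> B \<subset> B" using 3 by auto
        ultimately show ?thesis using that by blast
      qed
      have "awalk (Z A) [(Z A, Z C), (Z C, Z B)] (Z B)"
        using vert[OF B] arc_iff[OF A C(1)] arc_iff[OF C(1) B] C(2) by (auto simp: awalk_simps)
      moreover have "length q \<ge> 2" if "awalk (Z A) q (Z B)" for q
      proof (rule ccontr)
        assume "\<not> length q \<ge> 2"
        then show False
          using length_le_1_awalk[OF that] eq arc_iff[OF A B] 3 by auto
      qed
      moreover have "subset_dist U A B = 2" using 3 by (simp add: subset_dist_def)
      ultimately show ?thesis
        by (intro exI[of _ "[(Z A, Z C), (Z C, Z B)]"]) (auto simp: numeral_2_eq_2)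
    next
      case 4
      \<comment> \<open>If \<open>A\<close> has two points, the path is \<open>A\<close>,
        \<open>{a}\<close>, \<open>insert a B\<close>, \<open>B\<close>. Otherwise \<open>B\<close>
        has two, since \<open>card U \<ge> 3\<close>, and the path is \<open>A\<close>,
        \<open>insert b A\<close>, \<open>{b}\<close>, \<open>B\<close>.\<close>
      obtain C D where CD: "C \<in> proper_subsets U" "D \<in> proper_subsets U"
        "A \<subset> C \<or> C \<subset> A" "C \<subset> D \<or> D \<subset> C" "D \<subset> B \<or> B \<subset> D"
      proof (cases "card A \<ge> 2")
        case True
        obtain a where a: "a \<in> A" using sub by auto
        have "A \<noteq> {a}" using True by auto
        then have "{a} \<subset> A" "insert a B \<noteq> U" "a \<notin> B" using 4 a sub by auto
        then show ?thesis
          using that[of "{a}" "insert a B"] a sub by (auto simp: proper_subsets_iff)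
      next
        case False
        obtain b where b: "b \<in> B" using sub by auto
        have "card U = card A + card B"
          using 4 sub finite_U by (simp add: card_Diff_subset finite_subset card_mono)
        then have "B \<noteq> {b}" using False card_U by auto
        then have "{b} \<subset> B" "insert b A \<noteq> U" "b \<notin> A" using 4 b sub by auto
        then show ?thesis
          using that[of "insert b A" "{b}"] b sub by (auto simp: proper_subsets_iff)
      qed
      let ?p = "[(Z A, Z C), (Z C, Z D), (Z D, Z B)]"
      have "awalk (Z A) ?p (Z B)"
        using vert[OF B] arc_iff[OF A CD(1)] arc_iff[OF CD(1,2)] arc_iff[OF CD(2) B] CD
        by (auto simp: awalk_simps)
      moreover have "length q \<ge> 3" if "awalk (Z A) q (Z B)" for q
      proof (rule ccontr)
        assume "\<not> length q \<ge> 3"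
        then have "\<exists>w\<in>pverts G. (Z A, w) \<in> parcs G \<and> (w, Z B) \<in> parcs G"
          using short_awalk[OF that] eq arc_iff[OF A B] 4 by auto
        then obtain E where E: "E \<in> proper_subsets U" "(Z A, Z E) \<in> parcs G" "(Z E, Z B) \<in> parcs G"
          unfolding pverts_eq by blast
        then have "A \<subset> E \<or> E \<subset> A" "E \<subset> B \<or> B \<subset> E"
          using arc_iff[OF A E(1)] arc_iff[OF E(1) B] by auto
        moreover have "E \<subseteq> U" "E \<noteq> {}" "E \<noteq> U" using E(1) by (auto simp: proper_subsets_iff)
        \<comment> \<open>A common neighbour would lie inside both sets and be empty, contain both
          and be \<open>U\<close>, or lie between them and nest two disjoint nonempty sets.\<close>
        ultimately show False using 4(3) sub by blast
      qed
      moreover have "subset_dist U A B = 3" using 4 by (simp add: subset_dist_def)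
      ultimately show ?thesis
        by (intro exI[of _ ?p]) (auto simp: numeral_3_eq_3)
    qed
  qed
  then show ?thesis using graph_dist_eqI by metis
qed

lemma strongly_resolves_Z:
  assumes "C \<in> proper_subsets U" "A \<in> proper_subsets U" "B \<in> proper_subsets U"
  shows "strongly_resolves G (Z C) (Z A) (Z B) \<longleftrightarrow> subset_resolves U C A B"
  unfolding strongly_resolves_def subset_resolves_def
  using assms by (simp add: graph_dist_Z flip: of_nat_add)

lemma strong_resolving_set_Z:
  assumes "W \<subseteq> proper_subsets U"
  shows "strong_resolving_set G (Z ` W) \<longleftrightarrow>
    (\<forall>A\<in>proper_subsets U. \<forall>B\<in>proper_subsets U. A \<noteq> B \<longrightarrow> (\<exists>C\<in>W. subset_resolves U C A B))"
proof -
  have "strong_resolving_set G (Z ` W) \<longleftrightarrow>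
    (\<forall>A\<in>proper_subsets U. \<forall>B\<in>proper_subsets U. Z A \<noteq> Z B \<longrightarrow> (\<exists>C\<in>W. strongly_resolves G (Z C) (Z A) (Z B)))"
    unfolding strong_resolving_set_def using assms by (auto simp: pverts_eq)
  also have "\<dots> \<longleftrightarrow> (\<forall>A\<in>proper_subsets U. \<forall>B\<in>proper_subsets U. A \<noteq> B \<longrightarrow> (\<exists>C\<in>W. subset_resolves U C A B))"
    using assms inj_Z by (intro ball_cong refl) (simp add: inj_on_eq_iff strongly_resolves_Z subset_iff cong: bex_cong)
  finally show ?thesis .
qed

theorem sdim_eq: "sdim G = enat (2 ^ card U - 2 * card U + 1)"
proof -
  have finP: "finite (proper_subsets U)" using finite_U by (simp add: proper_subsets_def)
  have cardP: "card (proper_subsets U) = 2 ^ card U - 2"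
    using card_proper_subsets finite_U card_U by fastforce
  \<comment> \<open>Keeps the subtractions on natural numbers from being truncated.\<close>
  have pow: "2 * card U \<le> 2 ^ card U"
  proof -
    have "2 * n \<le> (2::nat) ^ n" if "n \<ge> 3" for n
      using that by (induction n rule: dec_induct) auto
    then show ?thesis using card_U by blast
  qed
  have lower: "2 ^ card U - 2 * card U + 1 \<le> card W'" if W': "strong_resolving_set G W'" for W'
  proof -
    have "W' \<subseteq> Z ` proper_subsets U"
      using W' by (auto simp: strong_resolving_set_def pverts_eq)
    then obtain W where W: "W \<subseteq> proper_subsets U" "W' = Z ` W" by (meson subset_imageE)
    have "card (proper_subsets U - W) \<le> 2 * card U - 3"
      using card_unresolved_le[OF finite_U card_U W(1)] W' strong_resolving_set_Z[OF W(1)] W(2) by blast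
    moreover have "card (proper_subsets U - W) = card (proper_subsets U) - card W"
      using W(1) finP by (meson card_Diff_subset finite_subset)
    moreover have "card W' = card W"
      using W inj_Z by (metis card_image inj_on_subset)
    ultimately show ?thesis using cardP pow card_U by linarith
  qed
  obtain r where r: "r \<in> U" using card_U by fastforce
  then have cardr: "card (U - {r}) = card U - 1" using finite_U by simp
  then have "card (U - {r}) > 0" using card_U by simp
  then have "U - {r} \<noteq> {}" by (metis card.empty less_irrefl)
  then obtain F where F: "F \<subseteq> Pow (U - {r}) - {{}}" "laminar F" "card F = 2 * card (U - {r}) - 1"
    using ex_laminar_card[of "U - {r}"] finite_U by blast
  let ?W = "proper_subsets U - F"
  \<comment> \<open>Members of \<open>F\<close> avoid \<open>r\<close>, so none is all of
    \<open>U\<close>; removing \<open>F\<close> therefore saves \<open>card F\<close> vertices in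
    full.\<close>
  have FP: "F \<subseteq> proper_subsets U" using F(1) r by (fastforce simp: proper_subsets_iff)
  have "strong_resolving_set G (Z ` ?W)"
    using strong_resolving_set_Z[of ?W] laminar_complement_resolving[OF r F(1,2)] by blast
  moreover have "card (Z ` ?W) = 2 ^ card U - 2 * card U + 1"
  proof -
    have "card (Z ` ?W) = card ?W" using inj_Z by (meson Diff_subset card_image inj_on_subset)
    also have "\<dots> = card (proper_subsets U) - card F"
      using FP finP by (meson card_Diff_subset finite_subset)
    finally show ?thesis using F(3) cardr cardP pow card_U by simp
  qed
  ultimately show ?thesis
    unfolding sdim_def using lower finP
    by (intro antisym INF_greatest INF_lower2[of "Z ` ?W"]) auto
qed

end

section \<open>Ideals of a finite product of fields\<close>

text \<open>\<open>RDirProd_list_hom1\<close> makes Cons a homomorphism from the product of pairs,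
  where the operations are visibly componentwise.\<close>

lemma RDirProd_list_Cons_ops:
  assumes "x \<in> carrier R" "xs \<in> carrier (RDirProd_list Rs)" "y \<in> carrier R" "ys \<in> carrier (RDirProd_list Rs)"
  shows "(x # xs) \<otimes>\<^bsub>RDirProd_list (R # Rs)\<^esub> (y # ys) = (x \<otimes>\<^bsub>R\<^esub> y) # (xs \<otimes>\<^bsub>RDirProd_list Rs\<^esub> ys)"
    and "(x # xs) \<oplus>\<^bsub>RDirProd_list (R # Rs)\<^esub> (y # ys) = (x \<oplus>\<^bsub>R\<^esub> y) # (xs \<oplus>\<^bsub>RDirProd_list Rs\<^esub> ys)"
proof -
  have mem: "(x, xs) \<in> carrier (RDirProd R (RDirProd_list Rs))" "(y, ys) \<in> carrier (RDirProd R (RDirProd_list Rs))"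
    using assms by (auto simp: RDirProd_carrier)
  show "(x # xs) \<otimes>\<^bsub>RDirProd_list (R # Rs)\<^esub> (y # ys) = (x \<otimes>\<^bsub>R\<^esub> y) # (xs \<otimes>\<^bsub>RDirProd_list Rs\<^esub> ys)"
    using ring_hom_mult[OF RDirProd_list_hom1 mem]
    by (simp add: RDirProd_def DirProd_def monoid.defs)
  show "(x # xs) \<oplus>\<^bsub>RDirProd_list (R # Rs)\<^esub> (y # ys) = (x \<oplus>\<^bsub>R\<^esub> y) # (xs \<oplus>\<^bsub>RDirProd_list Rs\<^esub> ys)"
    using ring_hom_add[OF RDirProd_list_hom1 mem]
    by (simp add: RDirProd_def DirProd_def monoid.defs)
qed

lemma nth_ring_hom_RDirProd_list:
  assumes "i < length Rs"
  shows "(\<lambda>xs. xs ! i) \<in> ring_hom (RDirProd_list Rs) (Rs ! i)"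
  using assms
proof (induction Rs arbitrary: i)
  case (Cons R Rs)
  show ?case
  proof (rule ring_hom_memI)
    fix xs assume "xs \<in> carrier (RDirProd_list (R # Rs))"
    then show "xs ! i \<in> carrier ((R # Rs) ! i)"
      using RDirProd_list_carrier_mem Cons.prems by blast
  next
    fix xs ys assume "xs \<in> carrier (RDirProd_list (R # Rs))" "ys \<in> carrier (RDirProd_list (R # Rs))"
    then obtain x xs' y ys' where *: "xs = x # xs'" "ys = y # ys'"
      "x \<in> carrier R" "xs' \<in> carrier (RDirProd_list Rs)" "y \<in> carrier R" "ys' \<in> carrier (RDirProd_list Rs)"
      unfolding RDirProd_list_carrier by auto
    show "(xs \<otimes>\<^bsub>RDirProd_list (R # Rs)\<^esub> ys) ! i = xs ! i \<otimes>\<^bsub>(R # Rs) ! i\<^esub> ys ! i"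
      using * Cons ring_hom_mult by (cases i) (fastforce simp: RDirProd_list_Cons_ops)+
    show "(xs \<oplus>\<^bsub>RDirProd_list (R # Rs)\<^esub> ys) ! i = xs ! i \<oplus>\<^bsub>(R # Rs) ! i\<^esub> ys ! i"
      using * Cons ring_hom_add by (cases i) (fastforce simp: RDirProd_list_Cons_ops)+
  next
    have one: "\<one>\<^bsub>RDirProd_list (R # Rs)\<^esub> = \<one>\<^bsub>R\<^esub> # \<one>\<^bsub>RDirProd_list Rs\<^esub>"
      by (simp add: RDirProd_list_one)
    show "\<one>\<^bsub>RDirProd_list (R # Rs)\<^esub> ! i = \<one>\<^bsub>(R # Rs) ! i\<^esub>"
      using Cons ring_hom_one by (cases i) (fastforce simp: one)+
  qed
qed simp

text \<open>The product is seen only through its coordinate maps, which are jointly injective and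
  surjective; this hides both the isomorphism and the list encoding.\<close>

locale field_product = cring R for R :: "('a, 'm) ring_scheme" (structure) +
  fixes F :: "'i \<Rightarrow> ('b, 'k) ring_scheme" and U :: "'i set" and \<pi> :: "'i \<Rightarrow> 'a \<Rightarrow> 'b"
  assumes finite_index: "finite U"
    and field_F: "i \<in> U \<Longrightarrow> field (F i)"
    and proj_hom: "i \<in> U \<Longrightarrow> \<pi> i \<in> ring_hom R (F i)"
    and proj_eqI: "\<lbrakk>x \<in> carrier R; y \<in> carrier R; \<And>i. i \<in> U \<Longrightarrow> \<pi> i x = \<pi> i y\<rbrakk> \<Longrightarrow> x = y"
    and proj_surj: "(\<And>i. i \<in> U \<Longrightarrow> a i \<in> carrier (F i)) \<Longrightarrow> \<exists>x\<in>carrier R. \<forall>i\<in>U. \<pi> i x = a i"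
begin

text \<open>Indexing by the coordinates allowed to be nonzero, rather than by those forced to
  vanish, makes the correspondence preserve inclusion.\<close>

definition supported_ideal :: "'i set \<Rightarrow> 'a set" where
  "supported_ideal S = {x \<in> carrier R. \<forall>i \<in> U - S. \<pi> i x = \<zero>\<^bsub>F i\<^esub>}"

lemma proj_ring_hom_ring: "i \<in> U \<Longrightarrow> ring_hom_ring R (F i) (\<pi> i)"
  by (intro ring_hom_ringI2 ring_axioms proj_hom field.is_ring field_F)

lemma proj_simps:
  assumes "i \<in> U"
  shows "\<pi> i \<zero> = \<zero>\<^bsub>F i\<^esub>" "\<pi> i \<one> = \<one>\<^bsub>F i\<^esub>"
    and "x \<in> carrier R \<Longrightarrow> \<pi> i x \<in> carrier (F i)"
    and "x \<in> carrier R \<Longrightarrow> y \<in> carrier R \<Longrightarrow> \<pi> i (x \<oplus>\<^bsub>R\<^esub> y) = \<pi> i x \<oplus>\<^bsub>F i\<^esub> \<pi> i y"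
    and "x \<in> carrier R \<Longrightarrow> y \<in> carrier R \<Longrightarrow> \<pi> i (x \<otimes> y) = \<pi> i x \<otimes>\<^bsub>F i\<^esub> \<pi> i y"
    and "x \<in> carrier R \<Longrightarrow> \<pi> i (\<ominus> x) = \<ominus>\<^bsub>F i\<^esub> \<pi> i x"
proof -
  interpret h: ring_hom_ring R "F i" "\<pi> i" using proj_ring_hom_ring assms .
  show "\<pi> i \<zero> = \<zero>\<^bsub>F i\<^esub>" "\<pi> i \<one> = \<one>\<^bsub>F i\<^esub>"
    and "x \<in> carrier R \<Longrightarrow> \<pi> i x \<in> carrier (F i)"
    and "x \<in> carrier R \<Longrightarrow> y \<in> carrier R \<Longrightarrow> \<pi> i (x \<oplus>\<^bsub>R\<^esub> y) = \<pi> i x \<oplus>\<^bsub>F i\<^esub> \<pi> i y"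
    and "x \<in> carrier R \<Longrightarrow> y \<in> carrier R \<Longrightarrow> \<pi> i (x \<otimes> y) = \<pi> i x \<otimes>\<^bsub>F i\<^esub> \<pi> i y"
    and "x \<in> carrier R \<Longrightarrow> \<pi> i (\<ominus> x) = \<ominus>\<^bsub>F i\<^esub> \<pi> i x"
    by simp_all
qed

lemma field_ring_F: "i \<in> U \<Longrightarrow> ring (F i)"
  using field_F by (rule field.is_ring)

lemma ideal_supported_ideal: "ideal (supported_ideal S) R"
proof (rule idealI)
  show "subgroup (supported_ideal S) (add_monoid R)"
  proof (rule add.subgroupI)
    show "supported_ideal S \<noteq> {}"
      using zero_closed proj_simps(1) unfolding supported_ideal_def by blast
  qed (auto simp: supported_ideal_def proj_simps ring.ring_simprules field_ring_F
        simp flip: a_inv_def)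
qed (auto simp: supported_ideal_def proj_simps ring.ring_simprules field_ring_F intro: ring_axioms)

lemma supported_ideal_subset_iff:
  assumes "S \<subseteq> U"
  shows "supported_ideal S \<subseteq> supported_ideal T \<longleftrightarrow> S \<subseteq> T"
proof
  assume le: "supported_ideal S \<subseteq> supported_ideal T"
  \<comment> \<open>The test element is the idempotent with coordinates 1 on \<open>S\<close> and 0
    elsewhere; it separates because 1 differs from 0 in a field.\<close>
  have "(if i \<in> S then \<one>\<^bsub>F i\<^esub> else \<zero>\<^bsub>F i\<^esub>) \<in> carrier (F i)" if "i \<in> U" for i
    using field_ring_F[OF that] by (simp add: ring.ring_simprules)
  from proj_surj[OF this] obtain x where
    x: "x \<in> carrier R" "\<forall>i\<in>U. \<pi> i x = (if i \<in> S then \<one>\<^bsub>F i\<^esub> else \<zero>\<^bsub>F i\<^esub>)" by blast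
  have "x \<in> supported_ideal S" using x by (simp add: supported_ideal_def)
  then have xT: "x \<in> supported_ideal T" using le by blast
  show "S \<subseteq> T"
  proof
    fix i assume i: "i \<in> S"
    then interpret Fi: field "F i" using field_F assms by blast
    have "\<one>\<^bsub>F i\<^esub> \<noteq> \<zero>\<^bsub>F i\<^esub>" by simp
    then show "i \<in> T"
      using i x(2) xT assms by (force simp: supported_ideal_def)
  qed
qed (auto simp: supported_ideal_def)

lemma supported_ideal_UNIV: "supported_ideal U = carrier R"
  by (auto simp: supported_ideal_def)

lemma supported_ideal_empty: "supported_ideal {} = {\<zero>}"
  using proj_eqI[OF _ zero_closed] by (auto simp: supported_ideal_def proj_simps)

text \<open>Take for \<open>S\<close> the coordinates at which some member of \<open>I\<close> is
  nonzero. As nonzero field elements are units, such a member has multiples that realise every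
  element concentrated at that coordinate.\<close>

lemma ideal_eq_supported_ideal:
  assumes "ideal I R"
  shows "\<exists>S\<subseteq>U. I = supported_ideal S"
proof -
  interpret I: ideal I R by fact
  define S where "S = {i \<in> U. \<exists>x\<in>I. \<pi> i x \<noteq> \<zero>\<^bsub>F i\<^esub>}"
  have "I \<subseteq> supported_ideal S"
    using I.Icarr by (auto simp: supported_ideal_def S_def)
  \<comment> \<open>Generalised from \<open>S\<close> to its finite subsets, so that induction can
    split off one coordinate at a time.\<close>
  moreover have "supported_ideal T \<subseteq> I" if "finite T" "T \<subseteq> S" for T
    using that
  proof (induction T rule: finite_induct)
    case empty
    then show ?case by (simp add: supported_ideal_empty)
  next
    case (insert i T)
    have i: "i \<in> U" using insert.prems by (auto simp: S_def)
    interpret Fi: field "F i" using field_F i .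
    obtain y where y: "y \<in> I" "\<pi> i y \<noteq> \<zero>\<^bsub>F i\<^esub>" using insert.prems by (auto simp: S_def)
    have yR: "y \<in> carrier R" using y I.Icarr by blast
    have yi: "\<pi> i y \<in> Units (F i)" using y yR i by (simp add: Fi.field_Units proj_simps)
    show ?case
    proof
      fix x assume x: "x \<in> supported_ideal (insert i T)"
      then have xR: "x \<in> carrier R" by (simp add: supported_ideal_def)
      \<comment> \<open>\<open>z\<close> is concentrated at \<open>i\<close> and scaled so that
        \<open>z \<otimes> y\<close> is the part of \<open>x\<close> at \<open>i\<close>.\<close>
      have "(if j = i then \<pi> i x \<otimes>\<^bsub>F i\<^esub> inv\<^bsub>F i\<^esub> \<pi> i y else \<zero>\<^bsub>F j\<^esub>) \<in> carrier (F j)" if "j \<in> U" for j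
        using i xR yi field_ring_F[OF that] by (simp add: ring.ring_simprules proj_simps)
      from proj_surj[OF this] obtain z where z: "z \<in> carrier R"
        "\<forall>j\<in>U. \<pi> j z = (if j = i then \<pi> i x \<otimes>\<^bsub>F i\<^esub> inv\<^bsub>F i\<^esub> \<pi> i y else \<zero>\<^bsub>F j\<^esub>)" by blast
      \<comment> \<open>\<open>x'\<close> is \<open>x\<close> with coordinate \<open>i\<close>
        erased, so the induction hypothesis covers it.\<close>
      have "(if j = i then \<zero>\<^bsub>F i\<^esub> else \<pi> j x) \<in> carrier (F j)" if "j \<in> U" for j
        using xR that by (simp add: proj_simps)
      from proj_surj[OF this] obtain x' where
        x': "x' \<in> carrier R" "\<forall>j\<in>U. \<pi> j x' = (if j = i then \<zero>\<^bsub>F i\<^esub> else \<pi> j x)" by blast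
      have "x' \<in> supported_ideal T"
        using x' x by (auto simp: supported_ideal_def)
      then have x'I: "x' \<in> I" using insert by auto
      have "x = (z \<otimes> y) \<oplus>\<^bsub>R\<^esub> x'"
      proof (rule proj_eqI)
        fix j assume j: "j \<in> U"
        show "\<pi> j x = \<pi> j ((z \<otimes> y) \<oplus>\<^bsub>R\<^esub> x')"
        proof (cases "j = i")
          case True
          then show ?thesis using i z x' xR yR yi by (simp add: proj_simps Fi.m_assoc)
        next
          case False
          then show ?thesis using j z x' xR yR field_ring_F[OF j]
            by (simp add: proj_simps ring.ring_simprules)
        qed
      qed (use z x' xR yR in auto)
      then show "x \<in> I" using I.I_l_closed[OF y(1) z(1)] x'I by simp
    qed
  qed
  then have "supported_ideal S \<subseteq> I" using finite_index by (simp add: S_def)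
  ultimately show ?thesis by (intro exI[of _ S]) (auto simp: S_def)
qed

lemma inj_on_supported_ideal: "inj_on supported_ideal (Pow U)"
  by (intro inj_onI) (metis PowD supported_ideal_subset_iff subset_antisym order_refl)

text \<open>The two trivial ideals have supports \<open>{}\<close> and \<open>U\<close>; injectivity
  on \<open>Pow U\<close> lets them be removed on the side of the supports.\<close>

lemma pverts_inclusion_ideal_graph:
  "pverts (inclusion_ideal_graph R) = supported_ideal ` proper_subsets U"
proof -
  have "{I. ideal I R} = supported_ideal ` Pow U"
    using ideal_supported_ideal ideal_eq_supported_ideal by blast
  then have "pverts (inclusion_ideal_graph R) = supported_ideal ` Pow U - supported_ideal ` {{}, U}"
    by (auto simp: inclusion_ideal_graph_def supported_ideal_UNIV supported_ideal_empty)
  also have "\<dots> = supported_ideal ` proper_subsets U"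
    unfolding proper_subsets_def
    by (rule inj_on_image_set_diff[OF inj_on_supported_ideal, symmetric]) auto
  finally show ?thesis .
qed

theorem sdim_inclusion_ideal_graph:
  assumes "card U \<ge> 3"
  shows "sdim (with_proj (inclusion_ideal_graph R)) = enat (2 ^ card U - 2 * card U + 1)"
proof -
  have psub: "supported_ideal A \<subset> supported_ideal B \<longleftrightarrow> A \<subset> B"
    if "A \<in> proper_subsets U" "B \<in> proper_subsets U" for A B
    using that supported_ideal_subset_iff by (auto simp: proper_subsets_iff less_le_not_le)
  have "parcs (inclusion_ideal_graph R) = {(I, J). I \<in> pverts (inclusion_ideal_graph R) \<and>
      J \<in> pverts (inclusion_ideal_graph R) \<and> (I \<subset> J \<or> J \<subset> I)}"
    by (simp add: inclusion_ideal_graph_def Let_def)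
  also have "\<dots> = {(supported_ideal A, supported_ideal B) | A B. A \<in> proper_subsets U \<and>
      B \<in> proper_subsets U \<and> (supported_ideal A \<subset> supported_ideal B \<or> supported_ideal B \<subset> supported_ideal A)}"
    unfolding pverts_inclusion_ideal_graph by blast
  also have "\<dots> = {(supported_ideal A, supported_ideal B) | A B.
      A \<in> proper_subsets U \<and> B \<in> proper_subsets U \<and> (A \<subset> B \<or> B \<subset> A)}"
    by (simp add: psub cong: conj_cong)
  finally interpret subset_comparability_graph "inclusion_ideal_graph R" U supported_ideal
    using finite_index assms pverts_inclusion_ideal_graph
      inj_on_subset[OF inj_on_supported_ideal, of "proper_subsets U"]
    by unfold_locales (simp_all add: proper_subsets_def)
  show ?thesis by (rule sdim_eq)
qed

end

theorem theorem2p2: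
  fixes R :: "('a, 'm) ring_scheme"
    and Fs :: "('b, 'k) ring_scheme list"
    and n :: nat
  assumes "n \<ge> 3"
    and "cring R"
    and "length Fs = n"
    and "\<And>i. i < n \<Longrightarrow> field (Fs ! i)"
    and "R \<simeq> RDirProd_list Fs"
  shows "sdim (with_proj (inclusion_ideal_graph R)) = enat (2 ^ n - 2 * n + 1)"
proof -
  obtain \<phi> where "\<phi> \<in> ring_iso R (RDirProd_list Fs)"
    using assms(5) by (auto simp: is_ring_iso_def)
  then have hom: "\<phi> \<in> ring_hom R (RDirProd_list Fs)"
    and bij: "bij_betw \<phi> (carrier R) (carrier (RDirProd_list Fs))"
    by (auto simp: ring_iso_def)
  \<comment> \<open>The coordinates of \<open>x\<close> are the entries of \<open>\<phi> x\<close>.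
    Joint injectivity and surjectivity both come from the bijectivity of
    \<open>\<phi>\<close>.\<close>
  interpret field_product R "\<lambda>i. Fs ! i" "{..<n}" "\<lambda>i x. \<phi> x ! i"
  proof (intro field_product.intro field_product_axioms.intro assms(2))
    fix i assume "i \<in> {..<n}"
    then show "field (Fs ! i)" using assms(4) by simp
    show "(\<lambda>x. \<phi> x ! i) \<in> ring_hom R (Fs ! i)"
      using ring_hom_trans[OF hom nth_ring_hom_RDirProd_list[of i Fs]] \<open>i \<in> {..<n}\<close> assms(3)
      by (simp add: comp_def)
  next
    fix x y assume xy: "x \<in> carrier R" "y \<in> carrier R" "\<And>i. i \<in> {..<n} \<Longrightarrow> \<phi> x ! i = \<phi> y ! i"
    then have "length (\<phi> x) = n" "length (\<phi> y) = n"
      using RDirProd_list_carrier_mem(1) ring_hom_closed[OF hom] assms(3) by blast+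
    then have "\<phi> x = \<phi> y" using xy(3) by (auto intro: nth_equalityI)
    then show "x = y" using bij xy by (meson bij_betw_imp_inj_on inj_onD)
  next
    fix a assume "\<And>i. i \<in> {..<n} \<Longrightarrow> a i \<in> carrier (Fs ! i)"
    then have "map a [0..<n] \<in> carrier (RDirProd_list Fs)"
      using assms(3) by (intro RDirProd_list_carrier_memI) auto
    then obtain x where "x \<in> carrier R" "\<phi> x = map a [0..<n]"
      using bij by (metis bij_betw_imp_surj_on imageE)
    then show "\<exists>x\<in>carrier R. \<forall>i\<in>{..<n}. \<phi> x ! i = a i" by force
  qed simp
  show ?thesis using sdim_inclusion_ideal_graph assms(1) by simp
qed

end
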